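(* $\mathrm{extr}(\mathcal{L}_{ij}^-)\subseteq\mathcal{U}_{ij}^{-1}\cup\mathcal{U}_{ij}^{-2}\cup\mathcal{U}_{ij}^{-3}\cup\mathcal{U}_{ij}^{-4}\cup\mathcal{U}_{ij}^{-5}$, where $\mathcal{L}_{ij}^-$ is defined in the context and $$\mathcal{U}_{ij}^{-1}:=\{(\pi_i,\pi_j,0,0,1)\in\mathbb{R}^5:(\pi_i,\pi_j)\in\Pi_{ji}\},$$ $$\mathcal{U}_{ij}^{-2}:=\{(\pi_i,\underline\pi_j,\underline f_{ij},l_{ij},1)\in\mathbb{R}^5: l_{ij}=H_{ij}\underline f_{ij}((\pi_i/\underline\pi_j)^{\hat\kappa}-1),\ \max\{\underline\pi_i,\underline\pi_j\underline r_{ij}\}\le\pi_i\le\min\{\bar\pi_i,\underline\pi_j\bar r_{ij}\}\},$$ $$\mathcal{U}_{ij}^{-3}:=\{(\pi_i,\bar\pi_j,\underline f_{ij},l_{ij},1)\in\mathbb{R}^5: l_{ij}=H_{ij}\underline f_{ij}((\pi_i/\bar\pi_j)^{\hat\kappa}-1),\ \max\{\underline\pi_i,\bar\pi_j\underline r_{ij}\}\le\pi_i\le\min\{\bar\pi_i,\bar\pi_j\bar r_{ij}\}\},$$ $$\mathcal{U}_{ij}^{-4}:=\{(\underline\pi_i,\pi_j,\underline f_{ij},l_{ij},1)\in\mathbb{R}^5: l_{ij}=H_{ij}\underline f_{ij}((\underline\pi_i/\pi_j)^{\hat\kappa}-1),\ \max\{\underline\pi_j,\underline\pi_i/\bar r_{ij}\}\le\pi_j\le\min\{\bar\pi_j,\underline\pi_i/\underline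 r_{ij}\}\},$$ $$\mathcal{U}_{ij}^{-5}:=\{(\bar\pi_i,\pi_j,\underline f_{ij},l_{ij},1)\in\mathbb{R}^5: l_{ij}=H_{ij}\underline f_{ij}((\bar\pi_i/\pi_j)^{\hat\kappa}-1),\ \max\{\underline\pi_j,\bar\pi_i/\bar r_{ij}\}\le\pi_j\le\min\{\bar\pi_j,\bar\pi_i/\underline r_{ij}\}\}.$$
   Context: Data: real numbers $0<\underline{\pi}_i\le\bar{\pi}_i$, $0<\underline{\pi}_j\le\bar{\pi}_j$, $\underline f_{ij}<0$, $1<\underline r_{ij}<\bar r_{ij}$, $H_{ij}>0$, $\hat\kappa\in(0,1)$. Define $$\Pi_{ji} := \{(\pi_i, \pi_j) \in [\underline{\pi}_{i}, \bar{\pi}_{i}]\times [\underline{\pi}_{j}, \bar{\pi}_{j}] : \underline{r}_{ij} \le \pi_i/\pi_j \le \bar{r}_{ij}\},$$ $$\mathcal{L}_{ij}^- := \{ (\pi_i, \pi_j, f_{ij}, l_{ij}, x_{ij}) \in \mathbb{R}^4 \times \{1\}: l_{ij} = H_{ij}((\pi_{i}/\pi_{j})^{\hat{\kappa}} -1) f_{ij},\ (\pi_i, \pi_j) \in \Pi_{ji},\ f_{ij} \in [\underline{f}_{ij}, 0] \}.$$ For a (possibly nonconvex) set $X$, $\mathrm{extr}(X)$ is the set of points of $X$ that are not of the form $\theta y'+(1-\theta)y''$ with $y',y''\in X$ distinct and $\theta\in(0,1)$. *)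

theory Defs
  imports "HOL-Analysis.Analysis"
begin

text \<open>The library predicate \<open>extreme_point_of\<close> does not presuppose convexity: it says that
  the point lies in \<open>X\<close> and in no open segment between two points of \<open>X\<close>; an open
  segment with coinciding end points is empty.\<close>

definition extr :: "'a::real_vector set \<Rightarrow> 'a set" where
  "extr X = {x. x extreme_point_of X}"

text \<open>Parameters: \<open>pil, piu\<close> and \<open>pjl, pju\<close> are the lower and upper bounds on
  \<open>\<pi>\<^sub>i\<close> and \<open>\<pi>\<^sub>j\<close>; \<open>rl, ru\<close> the bounds on the ratio \<open>\<pi>\<^sub>i / \<pi>\<^sub>j\<close>; \<open>fl\<close> the lower bound on
  \<open>f\<^sub>i\<^sub>j\<close>; \<open>H\<close> and \<open>\<kappa>\<close> the constants \<open>H\<^sub>i\<^sub>j\<close> and \<open>\<kappa>\<close>-hat. Points of 5-space are tuples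
  \<open>(\<pi>\<^sub>i, \<pi>\<^sub>j, f\<^sub>i\<^sub>j, l\<^sub>i\<^sub>j, x\<^sub>i\<^sub>j)\<close>.\<close>

definition Pi_ji :: "real \<Rightarrow> real \<Rightarrow> real \<Rightarrow> real \<Rightarrow> real \<Rightarrow> real \<Rightarrow> (real \<times> real) set" where
  "Pi_ji pil piu pjl pju rl ru =
    {(p, q). (p, q) \<in> {pil..piu} \<times> {pjl..pju} \<and> rl \<le> p / q \<and> p / q \<le> ru}"

definition L_minus :: "real \<Rightarrow> real \<Rightarrow> real \<Rightarrow> real \<Rightarrow> real \<Rightarrow> real \<Rightarrow> real \<Rightarrow> real \<Rightarrow> real
    \<Rightarrow> (real \<times> real \<times> real \<times> real \<times> real) set" where
  "L_minus pil piu pjl pju rl ru fl H \<kappa> =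
    {(p, q, f, l, x). x = 1 \<and> l = H * ((p / q) powr \<kappa> - 1) * f \<and>
       (p, q) \<in> Pi_ji pil piu pjl pju rl ru \<and> f \<in> {fl..0}}"

definition U1 :: "real \<Rightarrow> real \<Rightarrow> real \<Rightarrow> real \<Rightarrow> real \<Rightarrow> real
    \<Rightarrow> (real \<times> real \<times> real \<times> real \<times> real) set" where
  "U1 pil piu pjl pju rl ru = {(p, q, 0, 0, 1) | p q. (p, q) \<in> Pi_ji pil piu pjl pju rl ru}"

definition U2 :: "real \<Rightarrow> real \<Rightarrow> real \<Rightarrow> real \<Rightarrow> real \<Rightarrow> real \<Rightarrow> real \<Rightarrow> real
    \<Rightarrow> (real \<times> real \<times> real \<times> real \<times> real) set" where
  "U2 pil piu pjl rl ru fl H \<kappa> = {(p, pjl, fl, l, 1) | p l.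
     l = H * fl * ((p / pjl) powr \<kappa> - 1) \<and> max pil (pjl * rl) \<le> p \<and> p \<le> min piu (pjl * ru)}"

definition U3 :: "real \<Rightarrow> real \<Rightarrow> real \<Rightarrow> real \<Rightarrow> real \<Rightarrow> real \<Rightarrow> real \<Rightarrow> real
    \<Rightarrow> (real \<times> real \<times> real \<times> real \<times> real) set" where
  "U3 pil piu pju rl ru fl H \<kappa> = {(p, pju, fl, l, 1) | p l.
     l = H * fl * ((p / pju) powr \<kappa> - 1) \<and> max pil (pju * rl) \<le> p \<and> p \<le> min piu (pju * ru)}"

definition U4 :: "real \<Rightarrow> real \<Rightarrow> real \<Rightarrow> real \<Rightarrow> real \<Rightarrow> real \<Rightarrow> real \<Rightarrow> real
    \<Rightarrow> (real \<times> real \<times> real \<times> real \<times> real) set" where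
  "U4 pil pjl pju rl ru fl H \<kappa> = {(pil, q, fl, l, 1) | q l.
     l = H * fl * ((pil / q) powr \<kappa> - 1) \<and> max pjl (pil / ru) \<le> q \<and> q \<le> min pju (pil / rl)}"

definition U5 :: "real \<Rightarrow> real \<Rightarrow> real \<Rightarrow> real \<Rightarrow> real \<Rightarrow> real \<Rightarrow> real \<Rightarrow> real
    \<Rightarrow> (real \<times> real \<times> real \<times> real \<times> real) set" where
  "U5 piu pjl pju rl ru fl H \<kappa> = {(piu, q, fl, l, 1) | q l.
     l = H * fl * ((piu / q) powr \<kappa> - 1) \<and> max pjl (piu / ru) \<le> q \<and> q \<le> min pju (piu / rl)}"

end

(* A point of the set with fl < f < 0 is the midpoint of a segment along which only f varies,
   since l is linear in f.  A point with (p, q) in the interior of the box is the midpoint of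
   a segment along which (p, q) is rescaled, since the ratio p / q, and hence l, is constant there.
   So an extreme point has f = 0, or has f minimal and (p, q) on the boundary of the box. *)
theory Submission
  imports Defs
begin

text \<open>For nonzero \<open>d\<close> the points \<open>x - d\<close> and \<open>x + d\<close>
  are distinct with midpoint \<open>x\<close>, which would put \<open>x\<close> in an open segment
  of \<open>X\<close>. Both perturbation arguments below use extremality in this form.\<close>

lemma extr_symmetric_perturbation:
  assumes "x \<in> extr X" "x - d \<in> X" "x + d \<in> X"
  shows "d = 0"
proof (rule ccontr)
  assume "d \<noteq> 0"
  moreover have "midpoint (x - d) (x + d) = x"
    by (simp add: midpoint_def scaleR_2 flip: scaleR_add_left)
  moreover have "x - d \<noteq> x + d"
  proof
    assume "x - d = x + d"
    then have "2 *\<^sub>R d = 0" by (simp add: scaleR_2 algebra_simps)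
    with \<open>d \<noteq> 0\<close> show False by simp
  qed
  ultimately have "x \<in> open_segment (x - d) (x + d)"
    using midpoint_in_open_segment[of "x - d" "x + d"] by simp
  then show False
    using assms by (auto simp: extr_def extreme_point_of_def)
qed

lemma extr_L_minus_flow:
  assumes "(p, q, f, l, x) \<in> extr (L_minus pil piu pjl pju rl ru fl H \<kappa>)" (is "_ \<in> extr ?L")
  shows "f = fl \<or> f = 0"
proof (rule ccontr)
  assume neg: "\<not> ?thesis"
  have mem: "(p, q, f, l, x) \<in> ?L"
    using assms by (simp add: extr_def extreme_point_of_def)
  define c where "c = H * ((p / q) powr \<kappa> - 1)"
  \<comment> \<open>The largest step for which \<open>f - e\<close> and \<open>f + e\<close> both
    stay in \<open>{fl..0}\<close>.\<close>
  define e where "e = min (f - fl) (- f)"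
  have f: "fl < f" "f < 0" and l: "l = c * f"
    using mem neg by (auto simp: L_minus_def c_def)
  then have e: "0 < e" "fl \<le> f - e" "f + e \<le> 0"
    by (auto simp: e_def)
  \<comment> \<open>The slope \<open>c\<close> depends only on \<open>p\<close> and
    \<open>q\<close>, so changing \<open>f\<close> by \<open>e\<close> must change \<open>l\<close>
    by \<open>c * e\<close>.\<close>
  have "(p, q, f, l, x) - (0, 0, e, c * e, 0) \<in> ?L" "(p, q, f, l, x) + (0, 0, e, c * e, 0) \<in> ?L"
    using mem e l by (auto simp: L_minus_def simp flip: c_def) (auto simp: algebra_simps)
  from extr_symmetric_perturbation[OF assms this] e show False by (simp add: zero_prod_def)
qed

lemma extr_L_minus_boundary:
  assumes ext: "(p, q, f, l, x) \<in> extr (L_minus pil piu pjl pju rl ru fl H \<kappa>)" (is "_ \<in> extr ?L")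
    and "0 < pil" "0 < pjl"
  shows "p = pil \<or> p = piu \<or> q = pjl \<or> q = pju"
proof (rule ccontr)
  assume neg: "\<not> ?thesis"
  have mem: "(p, q, f, l, x) \<in> ?L"
    using ext by (simp add: extr_def extreme_point_of_def)
  then have int: "pil < p" "p < piu" "pjl < q" "q < pju"
    using neg by (auto simp: L_minus_def Pi_ji_def)
  then have pos: "0 < p" "0 < q" using assms by auto
  \<comment> \<open>The largest relative step: scaling \<open>(p, q)\<close> by \<open>1 - e\<close>
    or \<open>1 + e\<close> keeps it in the box.\<close>
  define e where "e = min (min ((p - pil) / p) ((piu - p) / p)) (min ((q - pjl) / q) ((pju - q) / q))"
  have e0: "0 < e" using int pos by (simp add: e_def)
  have "e \<le> (p - pil) / p" "e \<le> (piu - p) / p" "e \<le> (q - pjl) / q" "e \<le> (pju - q) / q"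
    by (auto simp: e_def)
  then have e: "e * p \<le> p - pil" "e * p \<le> piu - p" "e * q \<le> q - pjl" "e * q \<le> pju - q"
    using pos by (simp_all add: pos_le_divide_eq)
  \<comment> \<open>Indeed \<open>(1 - e) * p\<close> is at least \<open>pil\<close>. Hence the
    factor \<open>1 - e\<close> is positive, as \<open>scale\<close> requires.\<close>
  then have "0 < (1 - e) * p" using \<open>0 < pil\<close> by (simp add: algebra_simps)
  then have "e < 1" using pos by (simp add: zero_less_mult_iff)
  \<comment> \<open>The factor \<open>t\<close> cancels in the quotient, so the ratio bounds and the
    equation for \<open>l\<close> persist; only the box constraints need checking.\<close>
  have scale: "(t * p, t * q, f, l, x) \<in> ?L"
    if "0 < t" "pil \<le> t * p" "t * p \<le> piu" "pjl \<le> t * q" "t * q \<le> pju" for t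
    using mem that by (auto simp: L_minus_def Pi_ji_def)
  have "(p, q, f, l, x) - (e * p, e * q, 0, 0, 0) \<in> ?L"
    using scale[of "1 - e"] e e0 \<open>e < 1\<close> pos mult_pos_pos[OF e0 pos(1)] mult_pos_pos[OF e0 pos(2)] int
    by (simp add: algebra_simps)
  moreover have "(p, q, f, l, x) + (e * p, e * q, 0, 0, 0) \<in> ?L"
    using scale[of "1 + e"] e e0 pos mult_pos_pos[OF e0 pos(1)] mult_pos_pos[OF e0 pos(2)] int
    by (simp add: algebra_simps)
  ultimately show False
    using extr_symmetric_perturbation[OF ext] e0 pos by (fastforce simp: zero_prod_def)
qed

theorem proposition6:
  fixes pil piu pjl pju rl ru fl H \<kappa> :: real
  assumes "0 < pil" and "pil \<le> piu"
    and "0 < pjl" and "pjl \<le> pju"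
    and "fl < 0"
    and "1 < rl" and "rl < ru"
    and "H > 0"
    and "0 < \<kappa>" and "\<kappa> < 1"
  shows "extr (L_minus pil piu pjl pju rl ru fl H \<kappa>) \<subseteq>
      U1 pil piu pjl pju rl ru
    \<union> U2 pil piu pjl rl ru fl H \<kappa>
    \<union> U3 pil piu pju rl ru fl H \<kappa>
    \<union> U4 pil pjl pju rl ru fl H \<kappa>
    \<union> U5 piu pjl pju rl ru fl H \<kappa>"
proof
  fix z assume z: "z \<in> extr (L_minus pil piu pjl pju rl ru fl H \<kappa>)"
  obtain p q f l x where zeq: "z = (p, q, f, l, x)" by (cases z) auto
  have mem: "z \<in> L_minus pil piu pjl pju rl ru fl H \<kappa>"
    using z by (simp add: extr_def extreme_point_of_def)
  then have x: "x = 1" and l: "l = H * ((p / q) powr \<kappa> - 1) * f"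
    and P: "(p, q) \<in> Pi_ji pil piu pjl pju rl ru"
    by (auto simp: zeq L_minus_def)
  from P have b: "pil \<le> p" "p \<le> piu" "pjl \<le> q" "q \<le> pju" and r: "rl \<le> p / q" "p / q \<le> ru"
    by (auto simp: Pi_ji_def)
  have pos: "0 < q" "0 < rl" "0 < ru" using b assms by auto
  \<comment> \<open>The ratio bounds are solved for \<open>p\<close> here, as \<open>U2\<close> and
    \<open>U3\<close> need with \<open>q\<close> fixed, and next for \<open>q\<close>, as
    \<open>U4\<close> and \<open>U5\<close> need with \<open>p\<close> fixed.\<close>
  have rp: "q * rl \<le> p" "p \<le> q * ru"
    using r pos by (simp_all add: field_simps)
  then have rq: "p / ru \<le> q" "q \<le> p / rl"
    using pos by (simp_all add: field_simps)
  consider "f = 0" | "f = fl" "p = pil \<or> p = piu \<or> q = pjl \<or> q = pju"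
    using extr_L_minus_flow[OF z[unfolded zeq]]
      extr_L_minus_boundary[OF z[unfolded zeq] assms(1,3)] by blast
  then show "z \<in> U1 pil piu pjl pju rl ru
    \<union> U2 pil piu pjl rl ru fl H \<kappa>
    \<union> U3 pil piu pju rl ru fl H \<kappa>
    \<union> U4 pil pjl pju rl ru fl H \<kappa>
    \<union> U5 piu pjl pju rl ru fl H \<kappa>"
  proof cases
    case 1
    then show ?thesis using P l x by (simp add: zeq U1_def)
  next
    case 2
    \<comment> \<open>The faces \<open>p = pil\<close>, \<open>p = piu\<close>,
      \<open>q = pjl\<close>, \<open>q = pju\<close> lead to \<open>U4\<close>, \<open>U5\<close>,
      \<open>U2\<close>, \<open>U3\<close> respectively.\<close>
    then show ?thesis using b rp rq l x
      by (auto simp: zeq U2_def U3_def U4_def U5_def)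
  qed
qed

end
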